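(* There is no uncountable set $A \subseteq [0,1]^\omega$ such that for every continuous function $f : [0,1]^\omega \to \mathbb{R}$ the set $f[A]$ is countable.
   Context: "Countable" means of cardinality at most $\aleph_0$ (finite sets included). $[0,1]^\omega$ is the Hilbert cube with the product topology. The statement is a theorem of ZFC. *)

theory Defs
  imports "HOL-Analysis.Analysis"
begin

definition hilbert_cube :: "(nat \<Rightarrow> real) set"
  where "hilbert_cube = UNIV \<rightarrow> {0..1}"

text \<open>The library topology on functions is the product topology, so the subspace topology
  used by \<open>continuous_on hilbert_cube\<close> is the product topology of the unit intervals.\<close>

lemma top_of_set_hilbert_cube:
  "top_of_set hilbert_cube = product_topology (\<lambda>_::nat. top_of_set {0..1::real}) UNIV"
  using subtopology_product_topology [of "\<lambda>_::nat. euclidean :: real topology" UNIV "\<lambda>_. {0..1}"]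
  by (simp add: hilbert_cube_def euclidean_product_topology PiE_UNIV_domain)

end

theory Submission
  imports Defs "HOL-Complex_Analysis.Conformal_Mappings"
begin

text \<open>
  Suppose that every continuous real image of \<open>A\<close> is countable. A compact set \<open>Y\<close> has a continuous
  real function that separates its components, so \<open>A\<close> meets only countably many components of \<open>Y\<close>.

  There is a map \<open>F\<close> any two intersecting continua in a fibre of which are nested (a Bing map), and one
  of its fibres, \<open>X\<close>, meets \<open>A\<close> in an uncountable set. Fixing the first \<open>n\<close> coordinates in \<open>X\<close> and
  taking components gives continua \<open>K n x\<close>, only countably many for \<open>x\<close> in \<open>A \<inter> X\<close>, and so a single
  continuous \<open>G\<close> is nonconstant on all of them that are not singletons. For \<open>x\<close> in \<open>A \<inter> X\<close> the
  component \<open>W x\<close> of \<open>x\<close> in its fibre of \<open>(F, G)\<close> is nested with each \<open>K n x\<close> and cannot contain a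
  nondegenerate one, so it lies in all \<open>K n x\<close> and is \<open>{x}\<close>. Hence \<open>A \<inter> X\<close> is countable.
\<close>

section \<open>Geometric series of bounded functions\<close>

lemma continuous_on_suminf_geometric:
  fixes g :: "nat \<Rightarrow> 'a::topological_space \<Rightarrow> real"
  assumes "0 \<le> q" "q < 1"
    and cont: "\<And>n. continuous_on S (g n)"
    and bound: "\<And>n x. x \<in> S \<Longrightarrow> \<bar>g n x\<bar> \<le> 1"
  shows "continuous_on S (\<lambda>x. \<Sum>n. q ^ n * g n x)"
proof (rule uniform_limit_theorem)
  show "uniform_limit S (\<lambda>n x. \<Sum>i<n. q ^ i * g i x) (\<lambda>x. \<Sum>i. q ^ i * g i x) sequentially"
  proof (rule Weierstrass_m_test)
    show "norm (q ^ n * g n x) \<le> q ^ n" if "x \<in> S" for n x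
      using bound [OF that, of n] assms(1) by (simp add: abs_mult mult_left_le)
    show "summable (\<lambda>n. q ^ n)"
      using assms by (simp add: summable_geometric)
  qed
  show "\<forall>\<^sub>F n in sequentially. continuous_on S (\<lambda>x. \<Sum>i<n. q ^ i * g i x)"
    by (intro always_eventually allI continuous_intros cont)
qed auto

lemma summable_geometric_bounded:
  fixes v :: "nat \<Rightarrow> 'a::{real_normed_field, banach}"
  assumes "norm q < 1" "\<And>n. norm (v n) \<le> 1"
  shows "summable (\<lambda>n. q ^ n * v n)"
proof (rule summable_comparison_test')
  show "summable (\<lambda>n. norm q ^ n)"
    using assms(1) by (simp add: summable_geometric)
  show "norm (q ^ n * v n) \<le> norm q ^ n" for n
    using assms(2) [of n] by (simp add: norm_mult norm_power mult_left_le)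
qed

lemma geometric_tail_bound:
  fixes v :: "nat \<Rightarrow> real"
  assumes q: "0 < q" "q < 1" and v: "\<And>n. \<bar>v n\<bar> \<le> 1"
  shows "\<bar>(\<Sum>k. q ^ k * v k) - (\<Sum>k<n. q ^ k * v k)\<bar> \<le> q ^ n / (1 - q)"
proof -
  have sm: "summable (\<lambda>k. q ^ k * v k)"
    using summable_geometric_bounded [of q v] q v by simp
  have "(\<Sum>k. q ^ k * v k) - (\<Sum>k<n. q ^ k * v k) = (\<Sum>k. q ^ (k + n) * v (k + n))"
    using suminf_split_initial_segment [OF sm, of n] by simp
  moreover have "norm (\<Sum>k. q ^ (k + n) * v (k + n)) \<le> (\<Sum>k. q ^ n * q ^ k)"
  proof (rule norm_suminf_le)
    show "norm (q ^ (k + n) * v (k + n)) \<le> q ^ n * q ^ k" for k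
      using v [of "k + n"] q by (simp add: abs_mult power_add mult_left_le)
    show "summable (\<lambda>k. q ^ n * q ^ k)"
      using q by (intro summable_mult summable_geometric) auto
  qed
  moreover have "(\<Sum>k. q ^ n * q ^ k) = q ^ n / (1 - q)"
    using q by (subst suminf_mult) (auto simp: suminf_geometric summable_geometric)
  ultimately show ?thesis
    by simp
qed

text \<open>At the first index \<open>n\<close> where the sequences differ, the terms differ by
  \<open>(1/3) ^ n\<close>, while all later terms together can make up for at most half of
  that.\<close>

lemma ternary_expansion_inj:
  fixes v w :: "nat \<Rightarrow> real"
  assumes v: "\<And>n. v n \<in> {0, 1}" and w: "\<And>n. w n \<in> {0, 1}"
    and eq: "(\<Sum>n. (1/3) ^ n * v n) = (\<Sum>n. (1/3) ^ n * w n)"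
  shows "v = w"
proof (rule ccontr)
  assume "v \<noteq> w"
  then have ex: "\<exists>n. v n \<noteq> w n"
    by auto
  define n where "n = (LEAST n. v n \<noteq> w n)"
  have n: "v n \<noteq> w n" "\<And>k. k < n \<Longrightarrow> v k = w k"
    using LeastI_ex [OF ex] not_less_Least unfolding n_def by blast+
  have bd: "\<bar>v k\<bar> \<le> 1" "\<bar>w k\<bar> \<le> 1" "\<bar>v k - w k\<bar> \<le> 1" for k
    using v [of k] w [of k] by auto
  have "(\<Sum>k. (1/3) ^ k * (v k - w k)) = 0"
    using suminf_diff [of "\<lambda>k. (1/3) ^ k * v k" "\<lambda>k. (1/3) ^ k * w k"] bd eq
      summable_geometric_bounded [of "1/3" v] summable_geometric_bounded [of "1/3" w]
    by (simp add: right_diff_distrib)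
  moreover have "(\<Sum>k<Suc n. (1/3) ^ k * (v k - w k)) = (1/3) ^ n * (v n - w n)"
    using n(2) by simp
  ultimately have "\<bar>(1/3) ^ n * (v n - w n)\<bar> \<le> (1/3) ^ Suc n / (1 - 1/3)"
    using geometric_tail_bound [of "1/3" "\<lambda>k. v k - w k" "Suc n"] bd by simp
  moreover have "\<bar>v n - w n\<bar> = 1"
    using n(1) v [of n] w [of n] by auto
  moreover have "(0::real) < (1/3) ^ n"
    by simp
  ultimately show False
    by (simp add: abs_mult)
qed

section \<open>Components of compact sets\<close>

lemma Urysohn_metric:
  fixes S T :: "'a::metric_space set"
  assumes "closed S" "closed T" "S \<inter> T = {}"
  obtains u :: "'a \<Rightarrow> real"
  where "continuous_on UNIV u" "\<And>x. 0 \<le> u x \<and> u x \<le> 1"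
    "\<And>x. x \<in> S \<Longrightarrow> u x = 0" "\<And>x. x \<in> T \<Longrightarrow> u x = 1"
\<comment> \<open>\<open>infdist x {}\<close> is 0 by convention, so the usual quotient of distances
  works only for nonempty sets.\<close>
proof (cases "S = {} \<or> T = {}")
  case True
  then show ?thesis
    using that [of "\<lambda>_. 1"] that [of "\<lambda>_. 0"] by fastforce
next
  case False
  define u where "u x = infdist x S / (infdist x S + infdist x T)" for x
  have pos: "infdist x S + infdist x T > 0" for x
    using in_closed_iff_infdist_zero [OF assms(1), of x] in_closed_iff_infdist_zero [OF assms(2), of x]
      assms(3) False infdist_nonneg [of x S] infdist_nonneg [of x T]
    by (smt (verit) disjoint_iff)
  have "continuous_on UNIV u"
    unfolding u_def using pos by (intro continuous_intros) (metis less_irrefl)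
  moreover have "0 \<le> u x \<and> u x \<le> 1" for x
    using pos [of x] by (auto simp: u_def infdist_nonneg divide_simps)
  moreover have "u x = 0" if "x \<in> S" for x
    using that by (simp add: u_def)
  moreover have "u x = 1" if "x \<in> T" for x
    using that pos [of x] by (simp add: u_def)
  ultimately show ?thesis
    using that by blast
qed

text \<open>A clopen subset of \<open>Y\<close> is compact and relatively open, hence the trace on
  \<open>Y\<close> of a finite union from a countable base.\<close>

lemma countable_clopen_compact:
  fixes Y :: "'a::{metric_space, second_countable_topology} set"
  assumes "compact Y"
  shows "countable {U. openin (top_of_set Y) U \<and> closedin (top_of_set Y) U}"
proof -
  obtain \<B> :: "'a set set" where \<B>: "countable \<B>" "\<And>C. C \<in> \<B> \<Longrightarrow> open C"
    "\<And>S. open S \<Longrightarrow> \<exists>U. U \<subseteq> \<B> \<and> S = \<Union>U"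
    using univ_second_countable by metis
  have "{U. openin (top_of_set Y) U \<and> closedin (top_of_set Y) U}
      \<subseteq> (\<lambda>F. Y \<inter> \<Union>F) ` {F. finite F \<and> F \<subseteq> \<B>}"
  proof clarify
    fix U assume U: "openin (top_of_set Y) U" "closedin (top_of_set Y) U"
    obtain V where V: "open V" "U = Y \<inter> V"
      using U(1) by (auto simp: openin_open)
    obtain \<C> where \<C>: "\<C> \<subseteq> \<B>" "V = \<Union>\<C>"
      using \<B>(3) V(1) by blast
    have "compact U"
      using U(2) assms closedin_compact by blast
    then obtain F where "F \<subseteq> \<C>" "finite F" "U \<subseteq> \<Union>F"
      using compactE [of U \<C>] \<C> V \<B>(2) by (metis inf_le2 subsetD)
    then show "U \<in> (\<lambda>F. Y \<inter> \<Union>F) ` {F. finite F \<and> F \<subseteq> \<B>}"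
      using \<C> V by (intro image_eqI [of _ _ F]) auto
  qed
  moreover have "countable {F. finite F \<and> F \<subseteq> \<B>}"
    using countable_Collect_finite_subset [OF \<B>(1)] by simp
  ultimately show ?thesis
    by (meson countable_image countable_subset)
qed

text \<open>In a compact Hausdorff space components are quasi-components, and points in different
  quasi-components are separated by a clopen set.\<close>

lemma compact_component_clopen_separation:
  fixes Y :: "'a::metric_space set"
  assumes "compact Y" "x \<in> Y" "y \<in> Y" "\<not> connected_component Y x y"
  obtains U where "openin (top_of_set Y) U" "closedin (top_of_set Y) U" "x \<in> U" "y \<notin> U"
proof -
  have "compact_space (top_of_set Y)" "Hausdorff_space (top_of_set Y)"
    using assms(1) by (simp_all add: compact_space_subtopology Hausdorff_space_subtopology)
  then have eq: "quasi_components_of (top_of_set Y) = connected_components_of (top_of_set Y)"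
    by (simp add: quasi_eq_connected_components_of)
  have "\<not> quasi_component_of (top_of_set Y) x y"
  proof
    assume q: "quasi_component_of (top_of_set Y) x y"
    have "quasi_component_of_set (top_of_set Y) x \<in> connected_components_of (top_of_set Y)"
      using eq assms(2) by (metis quasi_component_in_quasi_components_of topspace_euclidean_subtopology)
    then have "connectedin (top_of_set Y) (quasi_component_of_set (top_of_set Y) x)"
      by (rule connectedin_connected_components_of)
    then have "connected (quasi_component_of_set (top_of_set Y) x)"
      "quasi_component_of_set (top_of_set Y) x \<subseteq> Y"
      by (auto simp: connectedin_subtopology)
    then show False
      using assms q unfolding connected_component_def
      by (metis (no_types, lifting) mem_Collect_eq quasi_component_of_refl topspace_euclidean_subtopology)
  qed
  then obtain T where T: "closedin (top_of_set Y) T" "openin (top_of_set Y) T" "x \<in> T \<longleftrightarrow> y \<notin> T"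
    using assms(2,3) unfolding quasi_component_of_def by auto
  moreover have "closedin (top_of_set Y) (Y - T)" "openin (top_of_set Y) (Y - T)"
    using T by (auto intro: closedin_diff openin_diff)
  ultimately show ?thesis
    using that assms(2,3) by (cases "x \<in> T") blast+
qed

text \<open>Each of the countably many clopen sets \<open>U n\<close> gives a Urysohn function
  \<open>u n\<close> with values 0 and 1 on \<open>Y\<close>. By uniqueness of ternary expansions
  with digits 0 and 1, the sum with weights \<open>(1/3) ^ n\<close> determines on \<open>Y\<close>
  which \<open>U n\<close> contain the point, and so its component.\<close>

lemma compact_components_separated_by_function:
  fixes Y :: "'a::{metric_space, second_countable_topology} set"
  assumes "compact Y"
  obtains h :: "'a \<Rightarrow> real" where "continuous_on UNIV h"
    "\<And>x y. \<lbrakk>x \<in> Y; y \<in> Y; h x = h y\<rbrakk> \<Longrightarrow> connected_component Y x y"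
proof -
  define \<U> where "\<U> = {U. openin (top_of_set Y) U \<and> closedin (top_of_set Y) U}"
  have "countable \<U>"
    unfolding \<U>_def by (rule countable_clopen_compact [OF assms])
  moreover have "{} \<in> \<U>"
    by (simp add: \<U>_def)
  ultimately obtain U :: "nat \<Rightarrow> 'a set" where U: "range U = \<U>"
    by (metis emptyE range_from_nat_into)
  have "\<exists>u. continuous_on UNIV u \<and> (\<forall>x. 0 \<le> u x \<and> u x \<le> (1::real)) \<and>
      (\<forall>x\<in>U n. u x = 0) \<and> (\<forall>x\<in>Y - U n. u x = 1)" for n
  proof -
    have "openin (top_of_set Y) (U n)" "closedin (top_of_set Y) (U n)"
      using U by (auto simp: \<U>_def)
    then have "closed (U n)" "closed (Y - U n)"
      using assms by (meson closedin_compact closedin_diff closedin_self compact_imp_closed)+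
    then show ?thesis
      using Urysohn_metric [of "U n" "Y - U n"] by (metis Diff_disjoint)
  qed
  then obtain u where u: "\<And>n. continuous_on UNIV (u n)" "\<And>n x. 0 \<le> u n x \<and> u n x \<le> (1::real)"
    "\<And>n x. x \<in> U n \<Longrightarrow> u n x = 0" "\<And>n x. x \<in> Y - U n \<Longrightarrow> u n x = 1"
    by metis
  show ?thesis
  proof
    show "continuous_on UNIV (\<lambda>x. \<Sum>n. (1/3) ^ n * u n x)"
      using u by (intro continuous_on_suminf_geometric) auto
    fix x y assume xy: "x \<in> Y" "y \<in> Y" "(\<Sum>n. (1/3) ^ n * u n x) = (\<Sum>n. (1/3) ^ n * u n y)"
    then have "(\<lambda>n. u n x) = (\<lambda>n. u n y)"
      using u(3,4) by (intro ternary_expansion_inj) (metis DiffI insertCI)+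
    then have eq: "u n x = u n y" for n
      by meson
    show "connected_component Y x y"
    proof (rule ccontr)
      assume "\<not> connected_component Y x y"
      then obtain V where V: "V \<in> \<U>" "x \<in> V" "y \<notin> V"
        using compact_component_clopen_separation [OF assms xy(1,2)] by (auto simp: \<U>_def)
      then obtain n where "V = U n"
        using U by blast
      then have "u n x = 0" "u n y = 1"
        using u(3,4) V xy by auto
      then show False
        using eq by simp
    qed
  qed
qed

lemma countable_components_meeting:
  fixes Y :: "'a::{metric_space, second_countable_topology} set"
  assumes "compact Y"
    and "\<And>f :: 'a \<Rightarrow> real. continuous_on UNIV f \<Longrightarrow> countable (f ` A)"
  shows "countable (connected_component_set Y ` (A \<inter> Y))"
proof -
  obtain h :: "'a \<Rightarrow> real" where h: "continuous_on UNIV h"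
    "\<And>x y. \<lbrakk>x \<in> Y; y \<in> Y; h x = h y\<rbrakk> \<Longrightarrow> connected_component Y x y"
    using compact_components_separated_by_function [OF assms(1)] by blast
  \<comment> \<open>\<open>g\<close> recovers a component from the value of \<open>h\<close> on it;
    whichever point \<open>SOME\<close> picks, the component is the same.\<close>
  define g where "g t = connected_component_set Y (SOME x. x \<in> Y \<and> h x = t)" for t
  have "connected_component_set Y x = g (h x)" if "x \<in> Y" for x
  proof -
    have "(SOME z. z \<in> Y \<and> h z = h x) \<in> Y \<and> h (SOME z. z \<in> Y \<and> h z = h x) = h x"
      using that by (metis (mono_tags, lifting) someI_ex)
    then show ?thesis
      unfolding g_def using h(2) that by (metis connected_component_eq mem_Collect_eq)
  qed
  then have "connected_component_set Y ` (A \<inter> Y) \<subseteq> g ` h ` A"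
    by blast
  then show ?thesis
    using assms(2) [OF h(1)] by (meson countable_image countable_subset)
qed

section \<open>Bing maps\<close>

text \<open>
  If \<open>s\<close> maps into \<open>[0,1]\<close>, a fibre of \<open>u + crook s u\<close> in which \<open>s\<close> runs from 0 to 1 is S-shaped: it
  can cross a level of \<open>u\<close> where the sine peaks only when \<open>s > 2/3\<close>, and a higher level where the sine
  bottoms out only when \<open>s < 1/3\<close>. Small perturbations keep this property, so the rescaled sum
  \<open>bing_map\<close> has it for countably many functions \<open>s\<close> at once.
\<close>

definition crook :: "real \<Rightarrow> real \<Rightarrow> real"
  where "crook s t =
    max 0 (1 - 3 * s) + (1 - max 0 (1 - 3 * s) - max 0 (3 * s - 2)) * sin (2 * pi * t) - max 0 (3 * s - 2)"

lemma crook_0 [simp]: "crook 0 t = 1" and crook_1 [simp]: "crook 1 t = -1"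
  by (simp_all add: crook_def)

text \<open>For \<open>s\<close> in \<open>[0,1]\<close> the value is a convex combination of 1, the
  sine and -1.\<close>

lemma abs_crook_le_1:
  assumes "0 \<le> s" "s \<le> 1"
  shows "\<bar>crook s t\<bar> \<le> 1"
proof -
  define c where "c = 1 - max 0 (1 - 3 * s) - max 0 (3 * s - 2)"
  have "c \<ge> 0"
    using assms by (auto simp: c_def max_def)
  then have "\<bar>c * sin (2 * pi * t)\<bar> \<le> c"
    by (simp add: abs_mult mult_left_le)
  then show ?thesis
    unfolding crook_def c_def [symmetric] using assms by (auto simp: c_def max_def split: if_splits)
qed

text \<open>For \<open>s \<le> 2/3\<close> the weight of -1 vanishes and the other two weights add
  up to 1, so where the sine is 1 the value does not depend on \<open>s\<close>.
  \<open>crook_trough\<close> is the mirror image.\<close>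

lemma crook_peak:
  assumes "s \<le> 2/3"
  shows "crook s (of_int j + 1/4) = 1"
proof -
  have "sin (2 * pi * (of_int j + 1/4)) = sin (2 * pi * of_int j + pi/2)"
    by (simp add: algebra_simps)
  also have "\<dots> = 1"
    unfolding sin_add by simp
  finally show ?thesis
    using assms by (simp add: crook_def)
qed

lemma crook_trough:
  assumes "1/3 \<le> s"
  shows "crook s (of_int j + 3/4) = -1"
proof -
  have "sin (2 * pi * (of_int j + 3/4)) = sin (2 * pi * of_int j + (pi + pi/2))"
    by (simp add: algebra_simps)
  also have "\<dots> = -1"
    unfolding sin_add by simp
  finally show ?thesis
    using assms by (simp add: crook_def)
qed

text \<open>At \<open>a\<close> the value of \<open>u\<close> is about \<open>\<rho> - 1\<close>,
  and on \<open>H\<close> the level \<open>j + 1/4\<close> is barred, since a peak there would lift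
  the sum above \<open>\<rho> + 1/15\<close>. At \<open>b\<close> it is about
  \<open>\<rho> + 1\<close>, and on \<open>K\<close> the level \<open>j + 3/4\<close> is barred by a
  trough. By connectedness \<open>H\<close> stays below the first level and \<open>K\<close> above
  the second.\<close>

lemma crook_fibre_disjoint:
  fixes u s :: "'a::topological_space \<Rightarrow> real"
  assumes u: "continuous_on UNIV u"
    and near: "\<And>x. x \<in> H \<union> K \<Longrightarrow> \<bar>u x + crook (s x) (u x) - \<rho>\<bar> \<le> 1/15"
    and H: "connected H" "\<And>x. x \<in> H \<Longrightarrow> s x \<le> 2/3" "a \<in> H" "s a = 0"
    and K: "connected K" "\<And>x. x \<in> K \<Longrightarrow> 1/3 \<le> s x" "b \<in> K" "s b = 1"
  shows "H \<inter> K = {}"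
proof -
  \<comment> \<open>The least integer with \<open>j + 1/4 > \<rho> - 1 + 1/15\<close>: at this
    height a crook value of 1 overshoots \<open>\<rho>\<close> by more than the tolerance.
    Minimality keeps \<open>j + 3/4\<close> well below \<open>\<rho> + 1 - 1/15\<close>.\<close>
  define j where "j = \<lfloor>\<rho> - 14/15 - 1/4\<rfloor> + 1"
  have j: "\<rho> - 14/15 < of_int j + 1/4" "of_int j + 1/4 \<le> \<rho> + 1/15"
    unfolding j_def by linarith+
  have "u x < of_int j + 1/4" if "x \<in> H" for x
  proof (rule ccontr)
    assume "\<not> u x < of_int j + 1/4"
    moreover have "u a < of_int j + 1/4"
    proof -
      have "\<bar>u a + 1 - \<rho>\<bar> \<le> 1/15"
        using near [of a] H(3,4) by simp
      then show ?thesis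
        using j by linarith
    qed
    moreover have "connected (u ` H)"
      using H(1) u by (meson connected_continuous_image continuous_on_subset subset_UNIV)
    ultimately have "of_int j + 1/4 \<in> u ` H"
      using connectedD_interval [of "u ` H" "u a" "u x"] H(3) that by (meson imageI not_less less_imp_le)
    then obtain z where "z \<in> H" "u z = of_int j + 1/4"
      by auto
    then show False
    proof -
      have "\<bar>u z + 1 - \<rho>\<bar> \<le> 1/15"
        using near [of z] crook_peak [of "s z" j] H(2) [of z] \<open>z \<in> H\<close> \<open>u z = _\<close> by simp
      then show ?thesis
        using j \<open>u z = _\<close> by linarith
    qed
  qed
  moreover have "of_int j + 3/4 < u x" if "x \<in> K" for x
  proof (rule ccontr)
    assume "\<not> of_int j + 3/4 < u x"
    moreover have "of_int j + 3/4 < u b"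
    proof -
      have "\<bar>u b + -1 - \<rho>\<bar> \<le> 1/15"
        using near [of b] K(3,4) by simp
      then show ?thesis
        using j by linarith
    qed
    moreover have "connected (u ` K)"
      using K(1) u by (meson connected_continuous_image continuous_on_subset subset_UNIV)
    ultimately have "of_int j + 3/4 \<in> u ` K"
      using connectedD_interval [of "u ` K" "u x" "u b"] K(3) that by (meson imageI not_less less_imp_le)
    then obtain z where "z \<in> K" "u z = of_int j + 3/4"
      by auto
    then show False
    proof -
      have "\<bar>u z + -1 - \<rho>\<bar> \<le> 1/15"
        using near [of z] crook_trough [of "s z" j] K(2) [of z] \<open>z \<in> K\<close> \<open>u z = _\<close> by simp
      then show ?thesis
        using j \<open>u z = _\<close> by linarith
    qed
  qed
  ultimately show ?thesis
    by fastforce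
qed

text \<open>\<open>bing_approx \<phi> n\<close> is the \<open>n\<close>-th partial sum of \<open>bing_map \<phi>\<close> multiplied by \<open>16 ^ n\<close>, so that
  the next term has amplitude 1 and the remaining ones add up to at most \<open>1/15\<close>.\<close>

primrec bing_approx :: "(nat \<Rightarrow> 'a \<Rightarrow> real) \<Rightarrow> nat \<Rightarrow> 'a \<Rightarrow> real"
  where
    "bing_approx \<phi> 0 x = 0"
  | "bing_approx \<phi> (Suc n) x = 16 * (bing_approx \<phi> n x + crook (\<phi> n x) (bing_approx \<phi> n x))"

definition bing_map :: "(nat \<Rightarrow> 'a \<Rightarrow> real) \<Rightarrow> 'a \<Rightarrow> real"
  where "bing_map \<phi> x = (\<Sum>n. (1/16) ^ n * crook (\<phi> n x) (bing_approx \<phi> n x))"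

lemma bing_approx_eq_sum:
  "bing_approx \<phi> n x = 16 ^ n * (\<Sum>k<n. (1/16) ^ k * crook (\<phi> k x) (bing_approx \<phi> k x))"
  by (induction n) (simp_all add: algebra_simps power_divide)

lemma continuous_on_crook:
  fixes f g :: "'a::t2_space \<Rightarrow> real"
  assumes "continuous_on S f" "continuous_on S g"
  shows "continuous_on S (\<lambda>x. crook (f x) (g x))"
  unfolding crook_def by (intro continuous_intros assms)

lemma continuous_on_bing_approx:
  fixes \<phi> :: "nat \<Rightarrow> 'a::t2_space \<Rightarrow> real"
  assumes "\<And>n. continuous_on S (\<phi> n)"
  shows "continuous_on S (bing_approx \<phi> n)"
  by (induction n) (auto intro!: continuous_intros continuous_on_crook assms)

lemma continuous_on_bing_map:
  fixes \<phi> :: "nat \<Rightarrow> 'a::t2_space \<Rightarrow> real"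
  assumes "\<And>n. continuous_on S (\<phi> n)" "\<And>n x. 0 \<le> \<phi> n x \<and> \<phi> n x \<le> 1"
  shows "continuous_on S (bing_map \<phi>)"
  unfolding bing_map_def using assms
  by (intro continuous_on_suminf_geometric continuous_on_crook continuous_on_bing_approx abs_crook_le_1) auto

text \<open>On the fibre of \<open>bing_map \<phi>\<close> over \<open>r\<close>, this yields for
  every \<open>n\<close> the hypothesis of \<open>crook_fibre_disjoint\<close> with
  \<open>u = bing_approx \<phi> n\<close> and \<open>\<rho> = 16 ^ n * r\<close>; the tolerance is
  \<open>1/16 + 1/16 ^ 2 + \<dots> = 1/15\<close>.\<close>

lemma bing_map_near:
  assumes "\<And>n. 0 \<le> \<phi> n x \<and> \<phi> n x \<le> 1"
  shows "\<bar>bing_approx \<phi> n x + crook (\<phi> n x) (bing_approx \<phi> n x) - 16 ^ n * bing_map \<phi> x\<bar> \<le> 1/15"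
proof -
  define S where "S = (\<Sum>k<Suc n. (1/16) ^ k * crook (\<phi> k x) (bing_approx \<phi> k x))"
  have "\<bar>bing_map \<phi> x - S\<bar> \<le> (1/16) ^ Suc n / (1 - 1/16)"
    unfolding bing_map_def S_def using assms by (intro geometric_tail_bound abs_crook_le_1) auto
  then have "16 ^ n * \<bar>bing_map \<phi> x - S\<bar> \<le> 1/15"
    by (simp add: power_divide field_simps)
  moreover have "16 ^ n * S = bing_approx \<phi> n x + crook (\<phi> n x) (bing_approx \<phi> n x)"
    using bing_approx_eq_sum [of \<phi> n x] by (simp add: S_def algebra_simps power_divide)
  moreover have "16 ^ n * \<bar>bing_map \<phi> x - S\<bar> = \<bar>16 ^ n * S - 16 ^ n * bing_map \<phi> x\<bar>"
    by (simp add: abs_mult abs_minus_commute flip: right_diff_distrib)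
  ultimately show ?thesis
    by simp
qed

text \<open>Equal to 1 within distance \<open>1/(i+1)\<close> of \<open>p\<close> and to 0 from
  distance \<open>2/(i+1)\<close> on. With \<open>p\<close> from a countable dense set, countably
  many bumps suffice to separate points from closed sets.\<close>

definition bump :: "'a::metric_space \<Rightarrow> nat \<Rightarrow> 'a \<Rightarrow> real"
  where "bump p i x = max 0 (min 1 (2 - dist p x * Suc i))"

lemma bump_separates:
  fixes K :: "'a::metric_space set"
  assumes dense: "\<And>U. \<lbrakk>open U; U \<noteq> {}\<rbrakk> \<Longrightarrow> \<exists>d\<in>D. d \<in> U"
    and "closed K" "a \<notin> K"
  obtains p i where "p \<in> D" "bump p i a = 1" "\<And>x. x \<in> K \<Longrightarrow> bump p i x = 0"
proof -
  obtain e where e: "e > 0" "ball a e \<subseteq> - K"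
    using assms(2,3) openE [of "- K" a] by auto
  \<comment> \<open>Since \<open>e > 3/(i+1)\<close>, a centre \<open>p\<close> within
    \<open>1/(i+1)\<close> of \<open>a\<close> is still more than \<open>2/(i+1)\<close> away from
    \<open>K\<close>.\<close>
  obtain i where i: "inverse (Suc i) < e/3"
    using e(1) reals_Archimedean [of "e/3"] by auto
  have i': "3 < e * Suc i"
    using i by (simp add: field_simps)
  obtain p where p: "p \<in> D" "p \<in> ball a (inverse (Suc i))"
    using dense [of "ball a (inverse (Suc i))"] by (metis centre_in_ball empty_iff open_ball
        of_nat_0_less_iff positive_imp_inverse_positive zero_less_Suc)
  have pa: "dist p a * Suc i < 1"
    using p(2) by (simp add: dist_commute field_simps)
  show ?thesis
  proof
    show "bump p i a = 1"
      using pa by (simp add: bump_def)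
    show "bump p i x = 0" if "x \<in> K" for x
    proof -
      have "e \<le> dist p a + dist p x"
        using e(2) that dist_triangle [of a x p] by (force simp: dist_commute)
      then have "e * Suc i \<le> (dist p a + dist p x) * Suc i"
        by (rule mult_right_mono) simp
      then have "2 \<le> dist p x * Suc i"
        using i' pa by (simp add: distrib_right)
      then show ?thesis
        by (simp add: bump_def)
    qed
  qed (rule p)
qed

text \<open>If \<open>H\<close> and \<open>K\<close> are not nested, take \<open>a\<close> in
  \<open>H - K\<close> and \<open>b\<close> in \<open>K - H\<close>. One function of a countable
  family vanishes at \<open>a\<close>, is 1 at \<open>b\<close>, at most 1/2 on \<open>H\<close> and
  at least 1/2 on \<open>K\<close>; its crook forces \<open>H\<close> and \<open>K\<close>
  apart.\<close>

theorem ex_bing_map: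
  obtains F :: "'a::{metric_space, second_countable_topology} \<Rightarrow> real"
  where "continuous_on UNIV F"
    "\<And>r H K. \<lbrakk>closed H; closed K; connected H; connected K; H \<subseteq> F -` {r}; K \<subseteq> F -` {r}; H \<inter> K \<noteq> {}\<rbrakk>
      \<Longrightarrow> H \<subseteq> K \<or> K \<subseteq> H"
proof -
  obtain D :: "'a set" where D: "countable D" "\<And>U. \<lbrakk>open U; U \<noteq> {}\<rbrakk> \<Longrightarrow> \<exists>d\<in>D. d \<in> U"
    using countable_dense_setE by blast
  \<comment> \<open>The first bump, near \<open>a\<close> and zero on \<open>K\<close>, pulls the
    value down from 1/2 to 0; the second, near \<open>b\<close> and zero on \<open>H\<close>, pushes
    it up to 1.\<close>
  define \<psi> where "\<psi> = (\<lambda>(p::'a, i, q, j) x. 1/2 - bump p i x / 2 + bump q j x / 2)"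
  have bump: "0 \<le> bump p i x" "bump p i x \<le> 1" for p x :: 'a and i
    by (simp_all add: bump_def)
  have \<psi>: "0 \<le> \<psi> k x \<and> \<psi> k x \<le> 1" "continuous_on UNIV (\<psi> k)" for k x
  proof -
    obtain p i q j where k: "k = (p, i, q, j)"
      by (metis prod.exhaust)
    show "0 \<le> \<psi> k x \<and> \<psi> k x \<le> 1"
      using bump [of p i x] bump [of q j x] by (simp add: k \<psi>_def)
    show "continuous_on UNIV (\<psi> k)"
      by (auto simp: k \<psi>_def bump_def intro!: continuous_intros)
  qed
  define I where "I = D \<times> (UNIV::nat set) \<times> D \<times> (UNIV::nat set)"
  have "countable I" "I \<noteq> {}"
    using D(1) D(2) [of UNIV] by (auto simp: I_def)
  then obtain e :: "nat \<Rightarrow> _" where e: "range e = I"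
    by (metis range_from_nat_into)
  define \<phi> where "\<phi> n = \<psi> (e n)" for n
  show ?thesis
  proof
    show "continuous_on UNIV (bing_map \<phi>)"
      using \<psi> by (intro continuous_on_bing_map) (auto simp: \<phi>_def)
    fix r and H K :: "'a set"
    assume HK: "closed H" "closed K" "connected H" "connected K"
      "H \<subseteq> bing_map \<phi> -` {r}" "K \<subseteq> bing_map \<phi> -` {r}" "H \<inter> K \<noteq> {}"
    show "H \<subseteq> K \<or> K \<subseteq> H"
    proof (rule ccontr)
      assume "\<not> ?thesis"
      then obtain a b where ab: "a \<in> H" "a \<notin> K" "b \<in> K" "b \<notin> H"
        by auto
      obtain p i where p: "p \<in> D" "bump p i a = 1" "\<And>x. x \<in> K \<Longrightarrow> bump p i x = 0"
        using bump_separates [OF D(2) HK(2) ab(2)] by blast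
      obtain q j where q: "q \<in> D" "bump q j b = 1" "\<And>x. x \<in> H \<Longrightarrow> bump q j x = 0"
        using bump_separates [OF D(2) HK(1) ab(4)] by blast
      have "(p, i, q, j) \<in> I"
        using p q by (simp add: I_def)
      then obtain n where n: "e n = (p, i, q, j)"
        using e by (metis imageE)
      have \<phi>n: "\<phi> n x = 1/2 - bump p i x / 2 + bump q j x / 2" for x
        by (simp add: \<phi>_def \<psi>_def n)
      have "H \<inter> K = {}"
      proof (rule crook_fibre_disjoint)
        show "continuous_on UNIV (bing_approx \<phi> n)"
          using \<psi> by (intro continuous_on_bing_approx) (auto simp: \<phi>_def)
        show "\<bar>bing_approx \<phi> n x + crook (\<phi> n x) (bing_approx \<phi> n x) - 16 ^ n * r\<bar> \<le> 1/15"
          if "x \<in> H \<union> K" for x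
          using bing_map_near [of \<phi> x n] \<psi> HK that by (auto simp: \<phi>_def)
        show "\<phi> n x \<le> 2/3" if "x \<in> H" for x
          using q(3) [OF that] bump(1) [of p i x] by (simp add: \<phi>n)
        show "1/3 \<le> \<phi> n x" if "x \<in> K" for x
          using p(3) [OF that] bump(1) [of q j x] by (simp add: \<phi>n)
        show "\<phi> n a = 0" "\<phi> n b = 1"
          using p q ab by (simp_all add: \<phi>n)
      qed (use HK ab in auto)
      then show False
        using HK(7) by simp
    qed
  qed
qed

section \<open>Subsets of the Hilbert cube with countable real images\<close>

text \<open>Each \<open>d\<close> is the coefficient sequence of a nonzero power series, holomorphic
  in the unit disc and so with countably many zeros there. Countably many such series cannot use up
  all \<open>c\<close> in \<open>(0,1)\<close>.\<close>

lemma ex_separating_parameter: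
  fixes D :: "(nat \<Rightarrow> real) set"
  assumes "countable D" and D: "\<And>d. d \<in> D \<Longrightarrow> d \<noteq> (\<lambda>_. 0)" "\<And>d n. d \<in> D \<Longrightarrow> \<bar>d n\<bar> \<le> 1"
  obtains c :: real where "0 < c" "c < 1" "\<And>d. d \<in> D \<Longrightarrow> (\<Sum>n. c ^ n * d n) \<noteq> 0"
proof -
  define f where "f d z = (\<Sum>n. z ^ n * complex_of_real (d n))" for d z
  have sums: "(\<lambda>n. z ^ n * complex_of_real (d n)) sums f d z" if "d \<in> D" "norm z < 1" for d z
    unfolding f_def using that D(2) by (intro summable_sums summable_geometric_bounded) auto
  have "countable {z \<in> ball 0 1. f d z = 0}" if d: "d \<in> D" for d
  proof (cases "f d constant_on ball 0 1")
    case True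
    then have const: "f d z = f d 0" if "z \<in> ball 0 1" for z
      using that by (metis centre_in_ball constant_on_def zero_less_one)
    have "f d 0 \<noteq> 0"
    proof
      assume 0: "f d 0 = 0"
      then have "d 0 = 0"
        using powser_zero [of "\<lambda>n. complex_of_real (d n)"] by (simp add: f_def mult.commute)
      then obtain m where m: "m > 0" "complex_of_real (d m) \<noteq> 0"
        using D(1) [OF d] by (metis bot_nat_0.not_eq_extremum of_real_eq_0_iff)
      \<comment> \<open>A power series with a nonzero coefficient has no zeros in some punctured
        disc around 0, so it cannot be constantly 0.\<close>
      obtain e where e: "0 < e" "\<And>z. z \<in> cball 0 e - {0} \<Longrightarrow> f d z \<noteq> 0"
      proof (rule powser_0_nonzero [of 1 0 "\<lambda>n. complex_of_real (d n)" "f d" m])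
        show "(\<lambda>n. complex_of_real (d n) * (z - 0) ^ n) sums f d z" if "cmod (z - 0) < 1" for z
          using sums [OF d, of z] that by (simp add: mult.commute)
      qed (use 0 m in simp_all)
      have "f d (complex_of_real (min e (1/2))) = 0"
        using const [of "complex_of_real (min e (1/2))"] 0 e(1) by simp
      moreover have "f d (complex_of_real (min e (1/2))) \<noteq> 0"
        using e(1) by (intro e(2)) auto
      ultimately show False
        by contradiction
    qed
    then have "{z \<in> ball 0 1. f d z = 0} = {}"
      using const by (metis (mono_tags, lifting) Collect_empty_eq)
    then show ?thesis
      by (metis countable_empty)
  next
    case False
    have "f d holomorphic_on ball 0 1"
      using sums [OF d] by (intro power_series_holomorphic [where a = "\<lambda>n. complex_of_real (d n)"])
        (simp add: mult.commute)
    \<comment> \<open>The disc is a countable union of compact sets, each containing only finitely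
      many zeros.\<close>
    moreover have "fsigma (ball (0::complex) 1)"
      by (metis fsigma_Union_compact image_subset_iff mem_Collect_eq open_Union_compact_subsets open_ball)
    ultimately show ?thesis
      using False by (intro holomorphic_countable_zeros) auto
  qed
  then have "countable (\<Union>d\<in>D. {z \<in> ball 0 1. f d z = 0})"
    using assms(1) by blast
  then have "countable (Re ` (\<Union>d\<in>D. {z \<in> ball 0 1. f d z = 0}))"
    by blast
  moreover have "uncountable {0<..<1::real}"
    by (simp add: uncountable_open_interval)
  ultimately obtain c where c: "c \<in> {0<..<1}" "c \<notin> Re ` (\<Union>d\<in>D. {z \<in> ball 0 1. f d z = 0})"
    by (meson countable_subset subsetI)
  show ?thesis
  proof
    show "(\<Sum>n. c ^ n * d n) \<noteq> 0" if "d \<in> D" for d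
    proof
      assume "(\<Sum>n. c ^ n * d n) = 0"
      moreover have "summable (\<lambda>n. c ^ n * d n)"
        using summable_geometric_bounded [of c d] c D(2) [OF that] by simp
      ultimately have "(\<lambda>n. complex_of_real (c ^ n * d n)) sums complex_of_real 0"
        by (metis sums_of_real summable_sums)
      then have "f d (complex_of_real c) = 0"
        by (simp add: f_def sums_iff)
      then show False
        using c that by (force intro: image_eqI [of _ _ "complex_of_real c"])
    qed
  qed (use c in auto)
qed

lemma compact_hilbert_cube: "compact hilbert_cube"
proof -
  have "compact_space (top_of_set hilbert_cube)"
    unfolding top_of_set_hilbert_cube by (simp add: compact_space_product_topology compact_space_subtopology)
  then show ?thesis
    by (metis compactin_euclidean_iff compactin_subspace subset_UNIV topspace_euclidean)
qed

text \<open>A truncation is given by \<open>n\<close> values, each from a countable set;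
  \<open>A\<close> itself may be uncountable.\<close>

lemma countable_truncations:
  fixes A :: "(nat \<Rightarrow> 'a::zero) set"
  assumes "\<And>n. countable ((\<lambda>x. x n) ` A)"
  shows "countable ((\<lambda>x i. if i < n then x i else 0) ` A)"
proof (induction n)
  case 0
  have "(\<lambda>x i. if i < 0 then x i else 0) ` A \<subseteq> {\<lambda>_. 0 :: 'a}"
    by auto
  then show ?case
    by (rule countable_subset) simp
next
  case (Suc n)
  let ?T = "(\<lambda>x i. if i < n then x i else 0) ` A"
  have "(\<lambda>x i. if i < Suc n then x i else 0) ` A \<subseteq> (\<lambda>(t, v). t(n := v)) ` (?T \<times> (\<lambda>x. x n) ` A)"
  proof clarify
    fix x assume "x \<in> A"
    then show "(\<lambda>i. if i < Suc n then x i else 0) \<in> (\<lambda>(t, v). t(n := v)) ` (?T \<times> (\<lambda>x. x n) ` A)"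
      by (intro image_eqI [of _ _ "(\<lambda>i. if i < n then x i else 0, x n)"]) (auto simp: fun_eq_iff)
  qed
  moreover have "countable (?T \<times> (\<lambda>x. x n) ` A)"
    using Suc assms by blast
  ultimately show ?case
    by (meson countable_image countable_subset)
qed

theorem mainTheorem4:
  "\<not> (\<exists>A \<subseteq> hilbert_cube. uncountable A \<and>
      (\<forall>f :: (nat \<Rightarrow> real) \<Rightarrow> real. continuous_on hilbert_cube f \<longrightarrow> countable (f ` A)))"
proof clarify
  fix A :: "(nat \<Rightarrow> real) set"
  assume A: "A \<subseteq> hilbert_cube" "uncountable A"
    and small: "\<forall>f :: (nat \<Rightarrow> real) \<Rightarrow> real. continuous_on hilbert_cube f \<longrightarrow> countable (f ` A)"
  have smallU: "countable (f ` A)" if "continuous_on UNIV f" for f :: "(nat \<Rightarrow> real) \<Rightarrow> real"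
    using small that continuous_on_subset by blast
  obtain F :: "(nat \<Rightarrow> real) \<Rightarrow> real" where F: "continuous_on UNIV F"
    and nested: "\<And>r H K. \<lbrakk>closed H; closed K; connected H; connected K; H \<subseteq> F -` {r}; K \<subseteq> F -` {r}; H \<inter> K \<noteq> {}\<rbrakk>
      \<Longrightarrow> H \<subseteq> K \<or> K \<subseteq> H"
    using ex_bing_map by blast
  \<comment> \<open>Only countably many fibres of \<open>F\<close> meet the uncountable set
    \<open>A\<close>, so one of them meets it in an uncountable set.\<close>
  have "A = (\<Union>r\<in>F ` A. A \<inter> F -` {r})"
    by auto
  then obtain r where r: "uncountable (A \<inter> F -` {r})"
    using A(2) smallU [OF F] by (metis countable_UN)
  define X where "X = hilbert_cube \<inter> F -` {r}"
  have "closed (F -` {r})"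
    using F by (simp add: continuous_closed_vimage continuous_on_eq_continuous_at)
  then have X: "compact X"
    unfolding X_def using compact_hilbert_cube by blast
  have AX: "uncountable (A \<inter> X)"
    using r A(1) by (simp add: X_def Int_absorb2 flip: Int_assoc)
  have comps: "countable (connected_component_set Y ` (A \<inter> Y))" if "compact Y" for Y
    using countable_components_meeting [OF that, of A] smallU by blast
  have coord: "continuous_on S (\<lambda>x::nat \<Rightarrow> real. x i)" for S i
    by (rule continuous_on_subset [OF continuous_on_product_coordinates]) simp

  \<comment> \<open>Components of the slices with the first \<open>n\<close> coordinates
    fixed\<close>
  define T where "T n x = (\<lambda>i. if i < n then x i else 0)" for n and x :: "nat \<Rightarrow> real"
  define Y where "Y n t = X \<inter> (\<Inter>i\<in>{..<n}. {y. y i = t i})" for n and t :: "nat \<Rightarrow> real"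
  define K where "K n x = connected_component_set (Y n x) x" for n x
  have Y: "compact (Y n t)" for n t
    unfolding Y_def using X
    by (intro compact_Int_closed closed_INT ballI closed_Collect_eq coord continuous_on_const)
  have YT: "Y n (T n x) = Y n x" for n x
    by (auto simp: Y_def T_def)
  \<comment> \<open>\<open>Y n t\<close> depends only on the first \<open>n\<close> entries of
    \<open>t\<close>, so indexing by the countable set of truncations still captures every slice
    through a point of \<open>A\<close>.\<close>
  define \<K> where "\<K> = (\<Union>n. \<Union>t \<in> T n ` A. connected_component_set (Y n t) ` (A \<inter> Y n t))"
  have "countable (T n ` A)" for n
    unfolding T_def by (intro countable_truncations smallU coord)
  then have "countable \<K>"
    unfolding \<K>_def by (intro countable_UN comps Y) auto
  have K\<K>: "K n x \<in> \<K>" if "x \<in> A \<inter> X" for n x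
  proof -
    have "K n x \<in> connected_component_set (Y n (T n x)) ` (A \<inter> Y n (T n x))"
      unfolding YT K_def using that by (auto simp: Y_def)
    then show ?thesis
      using that unfolding \<K>_def by blast
  qed
  have "\<exists>a b. S \<in> \<K> \<and> (\<nexists>x. S = {x}) \<longrightarrow> a \<in> S \<and> b \<in> S \<and> a \<noteq> b" for S
  proof (cases "S \<in> \<K>")
    case True
    then have "S \<noteq> {}"
      by (auto simp: \<K>_def connected_component_eq_empty simp del: Collect_empty_eq)
    then show ?thesis
      by (metis is_singletonI' is_singleton_def)
  qed auto
  then obtain a b where ab: "\<And>S. \<lbrakk>S \<in> \<K>; \<nexists>x. S = {x}\<rbrakk> \<Longrightarrow> a S \<in> S \<and> b S \<in> S \<and> a S \<noteq> b S"
    by metis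
  have \<K>sub: "S \<subseteq> hilbert_cube" if "S \<in> \<K>" for S
    using that connected_component_subset unfolding \<K>_def Y_def X_def by fastforce
  have cube: "0 \<le> x i \<and> x i \<le> 1" if "x \<in> hilbert_cube" for x i
    using that by (auto simp: hilbert_cube_def Pi_iff)

  \<comment> \<open>A function nonconstant on every nondegenerate member of
    \<open>\<K>\<close>\<close>
  let ?D = "(\<lambda>S i. a S i - b S i) ` {S \<in> \<K>. \<nexists>x. S = {x}}"
  obtain c where c: "0 < c" "c < 1" "\<And>d. d \<in> ?D \<Longrightarrow> (\<Sum>n. c ^ n * d n) \<noteq> 0"
  proof (rule ex_separating_parameter [of ?D])
    show "countable ?D"
      using \<open>countable \<K>\<close> by simp
    show "d \<noteq> (\<lambda>_. 0)" if "d \<in> ?D" for d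
      using that ab by (auto simp: fun_eq_iff)
    show "\<bar>d n\<bar> \<le> 1" if d: "d \<in> ?D" for d n
    proof -
      obtain S where S: "d = (\<lambda>i. a S i - b S i)" "S \<in> {S \<in> \<K>. \<nexists>x. S = {x}}"
        using d by (rule imageE)
      then have "a S \<in> hilbert_cube" "b S \<in> hilbert_cube"
        using ab \<K>sub by blast+
      then show ?thesis
        using cube [of "a S" n] cube [of "b S" n] S(1) by (auto simp: abs_le_iff)
    qed
  qed blast
  \<comment> \<open>\<open>G (a S) - G (b S)\<close> is the power series with coefficients
    \<open>a S n - b S n\<close> at \<open>c\<close>, and \<open>c\<close> was chosen so that none
    of these vanishes.\<close>
  define G where "G x = (\<Sum>n. c ^ n * x n)" for x :: "nat \<Rightarrow> real"
  have G: "continuous_on hilbert_cube G"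
    unfolding G_def using c cube coord
    by (intro continuous_on_suminf_geometric) (auto simp: abs_le_iff)
  have Gab: "G (a S) \<noteq> G (b S)" if S: "S \<in> \<K>" "\<nexists>x. S = {x}" for S
  proof -
    have sm: "summable (\<lambda>n. c ^ n * x n)" if "x \<in> hilbert_cube" for x
      using summable_geometric_bounded [of c x] c cube [OF that] by simp
    have "G (a S) - G (b S) = (\<Sum>n. c ^ n * (a S n - b S n))"
      unfolding G_def using ab [OF S] \<K>sub [OF S(1)]
      by (subst suminf_diff) (auto simp: right_diff_distrib intro!: sm)
    then show ?thesis
      using c(3) [of "\<lambda>i. a S i - b S i"] S by auto
  qed

  \<comment> \<open>Components of the fibres of \<open>(F, G)\<close>\<close>
  define Z where "Z s = X \<inter> {y \<in> hilbert_cube. G y = s}" for s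
  define W where "W x = connected_component_set (Z (G x)) x" for x
  have Z: "compact (Z s)" for s
  proof -
    have "closed {y \<in> hilbert_cube. G y = s}"
      using G compact_hilbert_cube by (intro continuous_closed_preimage_constant compact_imp_closed)
    then show ?thesis
      unfolding Z_def using X by blast
  qed
  define \<W> where "\<W> = (\<Union>s \<in> G ` A. connected_component_set (Z s) ` (A \<inter> Z s))"
  have "countable \<W>"
    unfolding \<W>_def using small G by (intro countable_UN comps Z) auto
  have W\<W>: "W x \<in> \<W>" if "x \<in> A \<inter> X" for x
    using that unfolding \<W>_def W_def by (auto simp: Z_def X_def)

  \<comment> \<open>This injects \<open>A \<inter> X\<close> into a countable family by
    \<open>x \<mapsto> {x}\<close>.\<close>
  have "{x} \<in> \<K> \<union> \<W>" if x: "x \<in> A \<inter> X" for x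
  proof (cases "\<exists>n. K n x = {x}")
    case True
    then show ?thesis
      using K\<K> [OF x] by (metis UnI1)
  next
    case False
    have xY: "x \<in> Y n x" "x \<in> Z (G x)" for n
      using x by (auto simp: Y_def Z_def X_def)
    then have xK: "x \<in> K n x" "x \<in> W x" for n
      by (simp_all add: K_def W_def)
    have "W x \<subseteq> K n x" for n
    proof -
      have "\<nexists>y. K n x = {y}"
        using False xK(1) [of n] by (metis singletonD)
      then have "G (a (K n x)) \<noteq> G (b (K n x))" "a (K n x) \<in> K n x" "b (K n x) \<in> K n x"
        using Gab ab K\<K> [OF x] by blast+
      moreover have "W x \<subseteq> {y. G y = G x}"
        using connected_component_subset [of "Z (G x)" x] by (auto simp: W_def Z_def)
      \<comment> \<open>\<open>G\<close> is constant on \<open>W x\<close> but takes two values on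
        \<open>K n x\<close>; nestedness then leaves only the other inclusion.\<close>
      ultimately have "\<not> K n x \<subseteq> W x"
        by (metis (mono_tags) mem_Collect_eq subsetD)
      moreover have "W x \<subseteq> K n x \<or> K n x \<subseteq> W x"
      proof (rule nested)
        show "closed (W x)" "closed (K n x)"
          unfolding W_def K_def by (intro closed_connected_component compact_imp_closed Y Z)+
        show "connected (W x)" "connected (K n x)"
          by (simp_all add: W_def K_def connected_connected_component)
        show "W x \<subseteq> F -` {r}" "K n x \<subseteq> F -` {r}"
          using connected_component_subset [of "Z (G x)" x] connected_component_subset [of "Y n x" x]
          by (auto simp: W_def K_def Z_def Y_def X_def)
        show "W x \<inter> K n x \<noteq> {}"
          using xK by blast
      qed
      ultimately show ?thesis
        by blast
    qed
    \<comment> \<open>Points of \<open>Y n x\<close> agree with \<open>x\<close> at indices below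
      \<open>n\<close>, so coordinate \<open>i\<close> needs \<open>n = Suc i\<close>.\<close>
    then have "y i = x i" if "y \<in> W x" for y i
      using that connected_component_subset [of "Y (Suc i) x" x] unfolding K_def Y_def by blast
    then have "W x = {x}"
      using xK by (auto simp: fun_eq_iff)
    then show ?thesis
      using W\<W> [OF x] by auto
  qed
  then have "(\<lambda>x. {x}) ` (A \<inter> X) \<subseteq> \<K> \<union> \<W>"
    by blast
  then have "countable ((\<lambda>x. {x}) ` (A \<inter> X))"
    using \<open>countable \<K>\<close> \<open>countable \<W>\<close> by (meson countable_Un countable_subset)
  then show False
    using AX countable_image_inj_on [of "\<lambda>x. {x}"] by (auto simp: inj_on_def)
qed

end
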